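(* Let $q$ be a prime power, $n\ge1$, $\sigma$ a generator of $\mathrm{Gal}(\mathbb{F}_{q^n}/\mathbb{F}_q)$, and $L=ax+bx^{\sigma}+cx^{\sigma^2}+dx^{\sigma^3}$ with $a,b,c,d\in\mathbb{F}_{q^n}$, $d\neq0$ and $a\neq 0$. Then for each $g\in\{0,1,2,3\}$, $L$ has exactly $q^g$ roots in $\mathbb{F}_{q^n}$ if and only if $1$ is an eigenvalue of $A_L$ with geometric multiplicity $g$ (where geometric multiplicity $0$ means $1$ is not an eigenvalue).
   Context: $C_L=\begin{pmatrix}0&0&-a/d\\1&0&-b/d\\0&1&-c/d\end{pmatrix}$ and $A_L=C_LC_L^{\sigma}\cdots C_L^{\sigma^{n-1}}$, where $C_L^{\sigma^i}$ denotes entrywise application of $\sigma^i$. *)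

theory Defs
  imports
    "HOL-Algebra.Algebraic_Closure_Type"
    "HOL-Algebra.Bij"
    "HOL-Algebra.Generated_Groups"
    "HOL-Number_Theory.Prime_Powers"
    "Jordan_Normal_Form.Char_Poly"
    "Jordan_Normal_Form.Matrix_Kernel"
begin

(* Gal(F/K) for a subfield K of F. Membership in Bij (carrier F) only fixes the values outside
   the carrier, as the library's own automorphism groups do. *)
definition galois_group ::
    "('a, 'b) ring_scheme \<Rightarrow> 'a set \<Rightarrow> ('a \<Rightarrow> 'a) monoid" where
  "galois_group F K =
     (BijGroup (carrier F))
       \<lparr>carrier := {\<tau> \<in> ring_iso F F \<inter> Bij (carrier F). \<forall>x\<in>K. \<tau> x = x}\<rparr>"

definition linearized ::
    "('a \<Rightarrow> 'a) \<Rightarrow> 'a \<Rightarrow> 'a \<Rightarrow> 'a \<Rightarrow> 'a \<Rightarrow> 'a :: field \<Rightarrow> 'a" where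
  "linearized \<sigma> a b c d x =
     a * x + b * \<sigma> x + c * (\<sigma> ^^ 2) x + d * (\<sigma> ^^ 3) x"

definition companion :: "'a \<Rightarrow> 'a \<Rightarrow> 'a \<Rightarrow> 'a \<Rightarrow> 'a :: field mat" where
  "companion a b c d =
     mat_of_rows_list 3 [[0, 0, - a / d],
                         [1, 0, - b / d],
                         [0, 1, - c / d]]"

(* The twisted product C * C^\<sigma> * ... * C^(\<sigma>^(n-1)), factors in increasing order
   from left to right. *)
definition twisted_companion_prod ::
    "nat \<Rightarrow> ('a \<Rightarrow> 'a) \<Rightarrow> 'a \<Rightarrow> 'a \<Rightarrow> 'a \<Rightarrow> 'a \<Rightarrow> 'a :: field mat" where
  "twisted_companion_prod n \<sigma> a b c d =
     foldr (*) (map (\<lambda>i. map_mat (\<sigma> ^^ i) (companion a b c d)) [0..<n]) (1\<^sub>m 3)"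

(* char_matrix A k is A - k I, so its kernel is the eigenspace of k. *)
definition geom_mult :: "'a :: field mat \<Rightarrow> 'a \<Rightarrow> nat" where
  "geom_mult A k = kernel_dim (char_matrix A k)"

(* Geometric multiplicity 0 is, by convention, the statement that k is not an eigenvalue. *)
definition eigenvalue_with_geom_mult :: "'a :: field mat \<Rightarrow> 'a \<Rightarrow> nat \<Rightarrow> bool" where
  "eigenvalue_with_geom_mult A k g \<longleftrightarrow>
     (if g = 0 then \<not> eigenvalue A k else eigenvalue A k \<and> geom_mult A k = g)"

end

theory Submission
  imports Defs "HOL-Library.Product_Plus" "HOL-Number_Theory.Residues"
begin

text \<open>
  The row vector \<open>v = (x, \<sigma> x, \<sigma>\<^sup>2 x)\<close> satisfies \<open>v C\<^sub>L = \<sigma> v\<close> exactly when \<open>L x = 0\<close>, so the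
  roots of \<open>L\<close> are the fixed points of the \<open>\<sigma>\<^sup>-\<^sup>1\<close>-semilinear map \<open>\<phi> v = \<sigma>\<^sup>-\<^sup>1(v C\<^sub>L)\<close>.
  As \<open>\<sigma>\<close> has order \<open>n\<close>, iterating gives \<open>\<phi>\<^sup>n v = v A\<^sub>L\<close>, so the fixed points of \<open>\<phi>\<^sup>n\<close> form the left
  eigenspace \<open>W\<close> of \<open>A\<^sub>L\<close> for \<open>1\<close>, which has as many elements as the right one, \<open>q\<^sup>n\<close> to the
  geometric multiplicity. Galois descent, in the counting form that \<open>\<phi>\<close> has \<open>r\<close> fixed points with
  \<open>r\<^sup>n = |W|\<close>, concludes.
\<close>

section \<open>Field homomorphisms and their iterates\<close>

lemma field_homI:
  fixes h :: "'a::field \<Rightarrow> 'b::field"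
  assumes "h 1 = 1" "\<And>x y. h (x + y) = h x + h y" "\<And>x y. h (x * y) = h x * h y"
  shows "field_hom h"
proof -
  have "h 0 + h 0 = h 0 + 0"
    using assms(2)[of 0 0] by simp
  then have "h 0 = 0"
    by (simp only: add_left_cancel)
  then show ?thesis
    by unfold_locales (use assms in auto)
qed

lemma field_hom_funpow:
  fixes h :: "'a::field \<Rightarrow> 'a"
  assumes "field_hom h"
  shows "field_hom (h ^^ k)"
proof -
  interpret field_hom h by fact
  show ?thesis
    by (rule field_homI; induction k) (simp_all add: hom_distribs)
qed

subsection \<open>Kernels over finite fields\<close>

lemma finite_carrier_vec: "finite (carrier_vec n :: 'a::finite vec set)"
proof (rule finite_subset)
  show "(carrier_vec n :: 'a vec set) \<subseteq> vec_of_list ` {xs. set xs \<subseteq> UNIV \<and> length xs = n}"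
  proof
    fix v :: "'a vec"
    assume "v \<in> carrier_vec n"
    then show "v \<in> vec_of_list ` {xs. set xs \<subseteq> UNIV \<and> length xs = n}"
      by (intro image_eqI[of _ _ "list_of_vec v"]) (auto simp: vec_list)
  qed
qed (intro finite_imageI finite_lists_length_eq finite)

text \<open>Coordinates in a basis \<open>B\<close> identify the kernel with the functions from
  \<open>B\<close> to the field. Through this count the geometric multiplicity becomes a
  cardinality, the form in which the later arguments handle it.\<close>

lemma card_mat_kernel:
  fixes A :: "'a::{field,finite} mat"
  assumes A: "A \<in> carrier_mat nr nc"
  shows "card (mat_kernel A) = card (UNIV :: 'a set) ^ kernel_dim A"
proof -
  interpret kernel nr nc A by unfold_locales (rule A)
  have fin: "finite (mat_kernel A)"
    using finite_subset[OF mat_kernel_carrier[OF A] finite_carrier_vec] .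
  \<comment> \<open>The kernel is a finite set, so it serves as its own finite spanning set.\<close>
  have "Ker.fin_dim"
    unfolding Ker.fin_dim_def
    using fin Ker.span_is_subset2[of "mat_kernel A"] Ker.in_own_span[of "mat_kernel A"]
    by (intro exI[of _ "mat_kernel A"]) auto
  then obtain B where B: "finite B" "Ker.basis B"
    using Ker.finite_basis_exists by blast
  then have sub: "B \<subseteq> mat_kernel A"
    by (simp add: Ker.basis_def)
  have ex1: "\<exists>!a. a \<in> B \<rightarrow>\<^sub>E UNIV \<and> Ker.lincomb a B = v" if "v \<in> mat_kernel A" for v
    using Ker.basis_criterion[OF B(1) sub] B(2) that by auto
  have closed: "Ker.lincomb a B \<in> mat_kernel A" for a :: "'a vec \<Rightarrow> 'a"
    using Ker.lincomb_closed[OF sub] by simp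
  have "bij_betw (\<lambda>a. Ker.lincomb a B) (B \<rightarrow>\<^sub>E UNIV) (mat_kernel A)"
    unfolding bij_betw_def
  proof
    show "inj_on (\<lambda>a. Ker.lincomb a B) (B \<rightarrow>\<^sub>E UNIV)"
    proof (rule inj_onI)
      fix a a' :: "'a vec \<Rightarrow> 'a"
      assume *: "a \<in> B \<rightarrow>\<^sub>E UNIV" "a' \<in> B \<rightarrow>\<^sub>E UNIV" "Ker.lincomb a B = Ker.lincomb a' B"
      from ex1[OF closed[of a]] obtain b
        where b: "\<forall>y. y \<in> B \<rightarrow>\<^sub>E UNIV \<and> Ker.lincomb y B = Ker.lincomb a B \<longrightarrow> y = b"
        by (rule ex1E)
      show "a = a'"
        using spec[OF b, of a] spec[OF b, of a'] * by simp
    qed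
    show "(\<lambda>a. Ker.lincomb a B) ` (B \<rightarrow>\<^sub>E UNIV) = mat_kernel A"
    proof (intro equalityI subsetI)
      fix v
      assume "v \<in> mat_kernel A"
      from ex1[OF this] show "v \<in> (\<lambda>a. Ker.lincomb a B) ` (B \<rightarrow>\<^sub>E UNIV)"
        by (elim ex1E conjE) (rule image_eqI, rule sym)
    qed (elim imageE, simp only: closed)
  qed
  then have "card (mat_kernel A) = card (B \<rightarrow>\<^sub>E (UNIV :: 'a set))"
    by (simp add: bij_betw_same_card)
  also have "\<dots> = card (UNIV :: 'a set) ^ card B"
    using B(1) by (simp add: card_funcsetE)
  also have "card B = kernel_dim A"
    using Ker.dim_basis[OF B] by simp
  finally show ?thesis .
qed

text \<open>If coordinate \<open>i\<close> of \<open>w\<close> is nonzero, every vector is uniquely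
  an element of the hyperplane plus a multiple of the \<open>i\<close>-th unit vector.\<close>

lemma card_hyperplane:
  fixes w :: "'a::{field,finite} vec"
  assumes w: "w \<in> carrier_vec n" "w \<noteq> 0\<^sub>v n"
  shows "card (UNIV :: 'a set) * card {u \<in> carrier_vec n. u \<bullet> w = 0} = card (carrier_vec n :: 'a vec set)"
proof -
  obtain i where i: "i < n" "w $ i \<noteq> 0"
    using w by (metis carrier_vecD eq_vecI index_zero_vec)
  let ?H = "{u \<in> carrier_vec n. u \<bullet> w = 0}"
  let ?e = "unit_vec n i :: 'a vec"
  have e: "?e \<bullet> w = w $ i"
    using i w by simp
  \<comment> \<open>In the inverse map, \<open>u \<bullet> w / w $ i\<close> is the multiple of
    \<open>?e\<close> whose removal makes \<open>u\<close> orthogonal to \<open>w\<close>.\<close>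
  have "bij_betw (\<lambda>(t, u). u + t \<cdot>\<^sub>v ?e) (UNIV \<times> ?H) (carrier_vec n)"
  proof (rule bij_betw_byWitness[where f' = "\<lambda>u. (u \<bullet> w / w $ i, u + (- (u \<bullet> w / w $ i)) \<cdot>\<^sub>v ?e)"])
    show "\<forall>p\<in>UNIV \<times> ?H.
      (\<lambda>u. (u \<bullet> w / w $ i, u + (- (u \<bullet> w / w $ i)) \<cdot>\<^sub>v ?e)) ((\<lambda>(t, u). u + t \<cdot>\<^sub>v ?e) p) = p"
      using i w e by (auto simp: add_scalar_prod_distrib[of _ n])
    show "\<forall>u\<in>carrier_vec n. (\<lambda>(t, u). u + t \<cdot>\<^sub>v ?e)
      (u \<bullet> w / w $ i, u + (- (u \<bullet> w / w $ i)) \<cdot>\<^sub>v ?e) = u"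
      by auto
    show "(\<lambda>(t, u). u + t \<cdot>\<^sub>v ?e) ` (UNIV \<times> ?H) \<subseteq> carrier_vec n"
      by auto
    show "(\<lambda>u. (u \<bullet> w / w $ i, u + (- (u \<bullet> w / w $ i)) \<cdot>\<^sub>v ?e)) ` carrier_vec n \<subseteq> UNIV \<times> ?H"
      using i w e by (auto simp: add_scalar_prod_distrib[of _ n])
  qed
  from bij_betw_same_card[OF this] show ?thesis
    by (simp add: card_cartesian_product)
qed

text \<open>The pairs on the left are those for \<open>A\<^sup>T\<close> with components swapped.\<close>

lemma card_orthogonal_pairs:
  fixes A :: "'a::{field,finite} mat"
  assumes A: "A \<in> carrier_mat n n"
  shows "card (UNIV :: 'a set) * card {(u, v). u \<in> carrier_vec n \<and> v \<in> carrier_vec n \<and> u \<bullet> (A *\<^sub>v v) = 0}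
    = (card (UNIV :: 'a set) - 1) * card (carrier_vec n :: 'a vec set) * card (mat_kernel A)
      + card (carrier_vec n :: 'a vec set) ^ 2" (is "?q * card ?P = _ * ?V * ?k + _")
proof -
  let ?C = "carrier_vec n :: 'a vec set"
  let ?fib = "\<lambda>v. {u \<in> ?C. u \<bullet> (A *\<^sub>v v) = 0}"
  have K: "mat_kernel A \<subseteq> ?C"
    using mat_kernel_carrier[OF A] .
  have fin: "finite ?C"
    by (rule finite_carrier_vec)
  have "card ?P = card (SIGMA v:?C. ?fib v)"
    by (rule bij_betw_same_card[of prod.swap], rule bij_betw_byWitness[where f' = prod.swap]) auto
  also have "\<dots> = (\<Sum>v\<in>?C. card (?fib v))"
    using fin by simp
  finally have "?q * card ?P = (\<Sum>v\<in>?C. ?q * card (?fib v))"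
    by (simp add: sum_distrib_left)
  \<comment> \<open>The fibre over \<open>v\<close> is the whole space if \<open>v\<close> is in the
    kernel and a hyperplane otherwise. Multiplied by \<open>?q\<close>, every fibre contributes
    \<open>?V\<close>, and a kernel vector contributes \<open>(?q - 1) * ?V\<close> more.\<close>
  also have "\<dots> = (\<Sum>v\<in>?C. (if v \<in> mat_kernel A then (?q - 1) * ?V else 0) + ?V)"
  proof (rule sum.cong[OF refl])
    fix v :: "'a vec"
    assume v: "v \<in> ?C"
    show "?q * card (?fib v) = (if v \<in> mat_kernel A then (?q - 1) * ?V else 0) + ?V"
    proof (cases "v \<in> mat_kernel A")
      case True
      then have "?fib v = ?C"
        using mat_kernelD[OF A] by auto
      then show ?thesis
        using True finite_UNIV_card_ge_0[where ?'a = 'a]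
        by (cases ?q) auto
    next
      case False
      then have "A *\<^sub>v v \<noteq> 0\<^sub>v n"
        using v mat_kernel[OF A] by auto
      then show ?thesis
        using False v card_hyperplane[of "A *\<^sub>v v" n] mult_mat_vec_carrier[OF A] by simp
    qed
  qed
  also have "\<dots> = (\<Sum>v\<in>mat_kernel A. (?q - 1) * ?V) + ?V * ?V"
    using fin K by (simp add: sum.distrib sum.inter_restrict[symmetric] Int_absorb1)
  finally show ?thesis
    by (simp add: power2_eq_square algebra_simps)
qed

text \<open>Double counting: swapping components matches the orthogonal pairs of \<open>A\<close>
  with those of its transpose, and the number of pairs determines the size of the kernel. This
  carries left eigenspaces over to right ones.\<close>

lemma card_mat_kernel_transpose:
  fixes A :: "'a::{field,finite} mat"
  assumes A: "A \<in> carrier_mat n n"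
  shows "card (mat_kernel A\<^sup>T) = card (mat_kernel A)"
proof -
  let ?P = "\<lambda>A. {(u, v). u \<in> carrier_vec n \<and> v \<in> carrier_vec n \<and> u \<bullet> (A *\<^sub>v v) = (0::'a)}"
  have adj: "u \<bullet> (A\<^sup>T *\<^sub>v v) = v \<bullet> (A *\<^sub>v u)"
    if "u \<in> carrier_vec n" "v \<in> carrier_vec n" for u v :: "'a vec"
    using that A transpose_vec_mult_scalar[OF A that]
      comm_scalar_prod[OF that(1) mult_mat_vec_carrier[OF _ that(2), of "A\<^sup>T"]] by simp
  have "card (?P A\<^sup>T) = card (?P A)"
    by (rule bij_betw_same_card[of prod.swap], rule bij_betw_byWitness[where f' = prod.swap])
      (auto simp: adj)
  then have "(card (UNIV :: 'a set) - 1) * card (carrier_vec n :: 'a vec set) * card (mat_kernel A\<^sup>T)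
        + card (carrier_vec n :: 'a vec set) ^ 2
      = (card (UNIV :: 'a set) - 1) * card (carrier_vec n :: 'a vec set) * card (mat_kernel A)
        + card (carrier_vec n :: 'a vec set) ^ 2"
    by (simp only: card_orthogonal_pairs[OF A, symmetric]
        card_orthogonal_pairs[OF transpose_carrier_mat[THEN iffD2, OF A], symmetric])
  moreover have "card (carrier_vec n :: 'a vec set) \<noteq> 0"
    using finite_carrier_vec[of n, where ?'a = 'a] zero_carrier_vec by (metis card_eq_0_iff empty_iff)
  moreover have "card (UNIV :: 'a set) > 1"
    using card_mono[of UNIV "{0, 1 :: 'a}"] by simp
  ultimately show ?thesis
    by simp
qed

subsection \<open>Galois descent by counting\<close>

text \<open>The matrices with entries \<open>(\<psi> ^^ j) (\<theta> ^ i)\<close> and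
  \<open>(\<psi> ^^ j) (f i)\<close> are inverse to each other; the two conclusions are the two
  orders of multiplication. The second is duality for the trace form.\<close>

lemma conjugate_dual_basis:
  fixes \<psi> :: "'a::field \<Rightarrow> 'a"
  assumes hom: "field_hom \<psi>" and N: "N > 0" and id: "\<psi> ^^ N = id"
    and \<theta>: "\<And>j. 0 < j \<Longrightarrow> j < N \<Longrightarrow> (\<psi> ^^ j) \<theta> \<noteq> \<theta>"
  obtains f where
    "\<And>j j'. j < N \<Longrightarrow> j' < N \<Longrightarrow>
      (\<Sum>i<N. (\<psi> ^^ j') (\<theta> ^ i) * (\<psi> ^^ j) (f i)) = (if j = j' then 1 else 0)"
    "\<And>i k. i < N \<Longrightarrow> k < N \<Longrightarrow>
      (\<Sum>j<N. (\<psi> ^^ j) (f i) * (\<psi> ^^ j) (\<theta> ^ k)) = (if i = k then 1 else 0)"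
proof -
  \<comment> \<open>The Lagrange polynomial of \<open>\<theta>\<close> among its conjugates: its coefficients are dual to the powers
    of \<open>\<theta>\<close>.\<close>
  define p where "p = (\<Prod>k\<in>{1..<N}. [:- (\<psi> ^^ k) \<theta>, 1:])"
  define f where "f i = coeff p i / poly p \<theta>" for i
  have poly_p: "poly p x = (\<Prod>k\<in>{1..<N}. x - (\<psi> ^^ k) \<theta>)" for x
    by (simp add: p_def poly_prod)
  have "degree p = N - 1"
    by (simp add: p_def degree_prod_eq_sum_degree)
  then have "{..degree p} = {..<N}"
    using N by auto
  then have poly_sum: "poly p x = (\<Sum>i<N. coeff p i * x ^ i)" for x
    by (simp add: poly_altdef)
  have "\<theta> - (\<psi> ^^ k) \<theta> \<noteq> 0" if "k \<in> {1..<N}" for k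
    using \<theta>[of k] that by fastforce
  then have nz: "poly p \<theta> \<noteq> 0"
    by (simp add: poly_p)
  \<comment> \<open>The exponent runs up to \<open>2 * N\<close> because \<open>m\<close> will be
    \<open>N - j + j'\<close>. Only \<open>m = N\<close> returns to \<theta>; every other
    \<open>m\<close> gives a conjugate at which \<open>p\<close> vanishes.\<close>
  have conj: "(\<Sum>i<N. f i * ((\<psi> ^^ m) \<theta>) ^ i) = (if m = N then 1 else 0)"
    if "0 < m" "m < 2 * N" for m
  proof -
    have "(\<Sum>i<N. f i * ((\<psi> ^^ m) \<theta>) ^ i) = poly p ((\<psi> ^^ m) \<theta>) / poly p \<theta>"
      by (simp add: poly_sum f_def sum_divide_distrib)
    also have "\<dots> = (if m = N then 1 else 0)"
    proof (cases "m = N")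
      case True
      then show ?thesis
        using nz id by simp
    next
      case False
      define k where "k = (if m < N then m else m - N)"
      have "(\<psi> ^^ m) \<theta> = (\<psi> ^^ k) \<theta>"
      proof (cases "m < N")
        case False
        then have "\<psi> ^^ m = \<psi> ^^ N \<circ> \<psi> ^^ (m - N)"
          by (simp flip: funpow_add)
        then show ?thesis
          using False id by (simp add: k_def)
      qed (simp add: k_def)
      moreover have "k \<in> {1..<N}"
        using that False by (auto simp: k_def)
      ultimately have "poly p ((\<psi> ^^ m) \<theta>) = 0"
        unfolding poly_p by (intro prod_zero) auto
      then show ?thesis
        using False by simp
    qed
    finally show ?thesis .
  qed
  have dual1: "(\<Sum>i<N. (\<psi> ^^ j') (\<theta> ^ i) * (\<psi> ^^ j) (f i)) = (if j = j' then 1 else 0)"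
    if "j < N" "j' < N" for j j'
  proof -
    interpret hj: field_hom "\<psi> ^^ j" by (rule field_hom_funpow[OF hom])
    interpret hj': field_hom "\<psi> ^^ j'" by (rule field_hom_funpow[OF hom])
    \<comment> \<open>Adding \<open>N\<close> keeps the exponent difference \<open>j' - j\<close>
      natural, so that \<open>\<psi> ^^ j\<close> can be pulled out of the whole sum.\<close>
    have "\<psi> ^^ j \<circ> \<psi> ^^ (N - j + j') = \<psi> ^^ N \<circ> \<psi> ^^ j'"
      using that by (simp flip: funpow_add)
    then have "(\<psi> ^^ j) ((\<psi> ^^ (N - j + j')) \<theta>) = (\<psi> ^^ j') \<theta>"
      using id by (simp add: fun_eq_iff)
    then have "(\<Sum>i<N. (\<psi> ^^ j') (\<theta> ^ i) * (\<psi> ^^ j) (f i))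
        = (\<psi> ^^ j) (\<Sum>i<N. f i * ((\<psi> ^^ (N - j + j')) \<theta>) ^ i)"
      by (simp add: hj.hom_sum hj.hom_mult hj.hom_power hj'.hom_power mult.commute)
    also have "\<dots> = (if j = j' then 1 else 0)"
      using that by (subst conj) auto
    finally show ?thesis .
  qed
  have dual2: "(\<Sum>j<N. (\<psi> ^^ j) (f i) * (\<psi> ^^ j) (\<theta> ^ k)) = (if i = k then 1 else 0)"
    if "i < N" "k < N" for i k
  proof -
    \<comment> \<open>For square matrices a right inverse is also a left inverse, so the second
      identity follows from the first.\<close>
    define T where "T = mat N N (\<lambda>(j, i). (\<psi> ^^ j) (\<theta> ^ i))"
    define G where "G = mat N N (\<lambda>(i, j). (\<psi> ^^ j) (f i))"
    have "T * G = 1\<^sub>m N"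
      by (rule eq_matI) (auto simp: T_def G_def scalar_prod_def dual1 atLeast0LessThan)
    then have "G * T = 1\<^sub>m N"
      by (rule mat_mult_left_right_inverse[rotated 2]) (auto simp: T_def G_def)
    then have "(G * T) $$ (i, k) = 1\<^sub>m N $$ (i, k)"
      by simp
    then show ?thesis
      using that by (simp add: T_def G_def scalar_prod_def atLeast0LessThan)
  qed
  show thesis
    using that dual1 dual2 by blast
qed

text \<open>Each fixed point of \<open>\<phi> ^^ N\<close> is uniquely a combination of the powers
  \<open>\<theta> ^ i\<close>, \<open>i < N\<close>, with fixed points of \<phi> as coefficients.
  The dual family \<open>f\<close> recovers the coefficients as traces.\<close>

lemma card_semilinear_fixed_points:
  fixes \<psi> :: "'a::field \<Rightarrow> 'a"
    and \<phi> :: "'v::{ab_group_add,finite} \<Rightarrow> 'v"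
    and scale :: "'a \<Rightarrow> 'v \<Rightarrow> 'v"
  assumes hom: "field_hom \<psi>" and N: "N > 0" and id: "\<psi> ^^ N = id"
    and \<theta>: "\<And>j. 0 < j \<Longrightarrow> j < N \<Longrightarrow> (\<psi> ^^ j) \<theta> \<noteq> \<theta>"
    and vs: "vector_space scale"
    and add: "\<And>v w. \<phi> (v + w) = \<phi> v + \<phi> w"
    and scale: "\<And>c v. \<phi> (scale c v) = scale (\<psi> c) (\<phi> v)"
  shows "card {v. (\<phi> ^^ N) v = v} = card {v. \<phi> v = v} ^ N"
proof -
  interpret vector_space scale by (rule vs)
  obtain f where
    f1: "\<And>j j'. j < N \<Longrightarrow> j' < N \<Longrightarrow>
      (\<Sum>i<N. (\<psi> ^^ j') (\<theta> ^ i) * (\<psi> ^^ j) (f i)) = (if j = j' then 1 else 0)"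
    and f2: "\<And>i k. i < N \<Longrightarrow> k < N \<Longrightarrow>
      (\<Sum>j<N. (\<psi> ^^ j) (f i) * (\<psi> ^^ j) (\<theta> ^ k)) = (if i = k then 1 else 0)"
    using conjugate_dual_basis[OF hom N id \<theta>] by blast
  have \<phi>_add: "(\<phi> ^^ j) (v + w) = (\<phi> ^^ j) v + (\<phi> ^^ j) w" for j v w
    by (induction j) (simp_all add: add)
  have \<phi>_0: "(\<phi> ^^ j) 0 = 0" for j
    using \<phi>_add[of j 0 0] by simp
  have \<phi>_sum: "(\<phi> ^^ j) (sum g I) = (\<Sum>i\<in>I. (\<phi> ^^ j) (g i))" for j g and I :: "nat set"
    by (induction I rule: infinite_finite_induct) (simp_all add: \<phi>_add \<phi>_0)
  have \<phi>_scale: "(\<phi> ^^ j) (scale c v) = scale ((\<psi> ^^ j) c) ((\<phi> ^^ j) v)" for j c v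
    by (induction j) (simp_all add: scale)
  let ?S = "{v. \<phi> v = v}" and ?W = "{v. (\<phi> ^^ N) v = v}"
  have fixed: "(\<phi> ^^ j) v = v" if "\<phi> v = v" for j v
    using that by (induction j) simp_all
  \<comment> \<open>\<open>?T\<close> takes the trace of each \<open>scale (f i) w\<close> under
    \<phi>, and \<open>?U\<close> recombines. The restriction to \<open>{..<N}\<close> makes the
    families extensional and hence countable by \<open>card_funcsetE\<close>.\<close>
  let ?T = "\<lambda>w. \<lambda>i\<in>{..<N}. \<Sum>j<N. (\<phi> ^^ j) (scale (f i) w)"
  let ?U = "\<lambda>s. \<Sum>i<N. scale (\<theta> ^ i) (s i)"
  have "bij_betw ?T ?W ({..<N} \<rightarrow>\<^sub>E ?S)"
  proof (rule bij_betw_byWitness[where f' = ?U])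
    show "\<forall>w\<in>?W. ?U (?T w) = w"
    proof
      fix w
      assume "w \<in> ?W"
      have "?U (?T w) = (\<Sum>i<N. \<Sum>j<N. scale (\<theta> ^ i * (\<psi> ^^ j) (f i)) ((\<phi> ^^ j) w))"
        by (simp add: \<phi>_scale scale_sum_right)
      \<comment> \<open>The trivial \<open>\<psi> ^^ 0\<close> exposes the instance
        \<open>j' = 0\<close> of \<open>f1\<close>, which leaves only the term
        \<open>j = 0\<close>.\<close>
      also have "\<dots> = (\<Sum>j<N. scale (\<Sum>i<N. (\<psi> ^^ 0) (\<theta> ^ i) * (\<psi> ^^ j) (f i)) ((\<phi> ^^ j) w))"
        by (subst sum.swap) (simp add: scale_sum_left)
      also have "\<dots> = (\<Sum>j<N. if j = 0 then w else 0)"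
        by (rule sum.cong[OF refl], subst f1) (use N in auto)
      finally show "?U (?T w) = w"
        using N by simp
    qed
    show "\<forall>s\<in>{..<N} \<rightarrow>\<^sub>E ?S. ?T (?U s) = s"
    proof
      fix s
      assume s: "s \<in> {..<N} \<rightarrow>\<^sub>E ?S"
      show "?T (?U s) = s"
      proof
        fix i
        show "?T (?U s) i = s i"
        proof (cases "i < N")
          case True
          have "(\<phi> ^^ j) (scale (f i) (?U s))
              = (\<Sum>k<N. scale ((\<psi> ^^ j) (f i) * (\<psi> ^^ j) (\<theta> ^ k)) (s k))" for j
            unfolding \<phi>_scale \<phi>_sum scale_sum_right
            by (rule sum.cong) (use s in \<open>auto simp: fixed PiE_iff\<close>)
          then have "?T (?U s) i = (\<Sum>j<N. \<Sum>k<N. scale ((\<psi> ^^ j) (f i) * (\<psi> ^^ j) (\<theta> ^ k)) (s k))"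
            using True by simp
          also have "\<dots> = (\<Sum>k<N. scale (\<Sum>j<N. (\<psi> ^^ j) (f i) * (\<psi> ^^ j) (\<theta> ^ k)) (s k))"
            by (subst sum.swap) (simp add: scale_sum_left)
          also have "\<dots> = (\<Sum>k<N. if i = k then s k else 0)"
            using True by (intro sum.cong) (simp_all only: f2 lessThan_iff, simp_all)
          finally show ?thesis
            using True by simp
        next
          case False
          then show ?thesis
            using s by (simp add: PiE_iff extensional_def)
        qed
      qed
    qed
    show "?T ` ?W \<subseteq> {..<N} \<rightarrow>\<^sub>E ?S"
    proof (intro image_subsetI PiE_I)
      fix w i
      assume w: "w \<in> ?W" and i: "i \<in> {..<N}"
      define x where "x = scale (f i) w"
      have x: "(\<phi> ^^ N) x = x"
        using w id by (simp add: x_def \<phi>_scale)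
      \<comment> \<open>A trace is fixed because \<phi> permutes its terms cyclically. Adding
        \<open>x\<close> to both sides below compares two ways of splitting the sum over
        \<open>N + 1\<close> terms.\<close>
      have "\<phi> (\<Sum>j<N. (\<phi> ^^ j) x) = (\<Sum>j<N. (\<phi> ^^ Suc j) x)"
        using \<phi>_sum[of 1] by simp
      also have "\<dots> = (\<Sum>j<N. (\<phi> ^^ j) x)"
      proof -
        have "(\<Sum>j<N. (\<phi> ^^ Suc j) x) + x = (\<Sum>j<N. (\<phi> ^^ j) x) + x"
          using sum.lessThan_Suc_shift[of "\<lambda>j. (\<phi> ^^ j) x" N]
            sum.lessThan_Suc[of "\<lambda>j. (\<phi> ^^ j) x" N] x by (simp add: add.commute)
        then show ?thesis
          by simp
      qed
      finally show "?T w i \<in> ?S"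
        using i by (simp add: x_def)
    qed simp
    show "?U ` ({..<N} \<rightarrow>\<^sub>E ?S) \<subseteq> ?W"
    proof (intro image_subsetI CollectI)
      fix s
      assume "s \<in> {..<N} \<rightarrow>\<^sub>E ?S"
      then show "(\<phi> ^^ N) (?U s) = ?U s"
        unfolding \<phi>_sum \<phi>_scale id by (intro sum.cong) (auto simp: fixed PiE_iff)
    qed
  qed
  from bij_betw_same_card[OF this] show ?thesis
    by (simp add: card_funcsetE)
qed

subsection \<open>The order of a generator of the Galois group\<close>

lemma field_hom_eq_on_generator:
  fixes h :: "'a::field \<Rightarrow> 'b::field"
  assumes "field_hom h" "field_hom h'" "h \<theta> = h' \<theta>"
    and gen: "\<And>x. x \<noteq> 0 \<Longrightarrow> \<exists>i::nat. x = \<theta> ^ i"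
  shows "h = h'"
proof
  interpret h: field_hom h by fact
  interpret h': field_hom h' by fact
  fix x
  show "h x = h' x"
  proof (cases "x = 0")
    case False
    then obtain i :: nat where "x = \<theta> ^ i"
      using gen by blast
    then show ?thesis
      using assms(3) by (simp add: h.hom_power h'.hom_power)
  qed simp
qed

section \<open>The field as a ring record, and its Galois group\<close>

lemma carrier_ring_of_type_algebra [simp]: "carrier (ring_of_type_algebra :: 'a::field ring) = UNIV"
  by (simp add: ring_of_type_algebra_def)

lemma finite_field_generator:
  obtains \<theta> :: "'a::{field,finite}" where "\<And>x. x \<noteq> 0 \<Longrightarrow> \<exists>i::nat. x = \<theta> ^ i"
proof -
  interpret R: field "ring_of_type_algebra :: 'a ring"
    by (rule field_from_type_algebra)
  have pow: "x [^]\<^bsub>ring_of_type_algebra :: 'a ring\<^esub> i = x ^ i" for x and i :: nat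
    by (induction i) (simp_all add: ring_of_type_algebra_def mult.commute)
  have "finite (carrier (ring_of_type_algebra :: 'a ring))"
    by simp
  from R.finite_field_mult_group_has_gen[OF this] obtain \<theta> :: 'a where
    "UNIV - {\<zero>\<^bsub>ring_of_type_algebra\<^esub>} = {\<theta> ^ i |i::nat. True}"
    unfolding Multiplicative_Group.carrier_mult_of Multiplicative_Group.nat_pow_mult_of pow
      carrier_ring_of_type_algebra by auto
  then have "UNIV - {0} = {\<theta> ^ i |i::nat. True}"
    by (simp add: ring_of_type_algebra_def)
  then show thesis
    using that by blast
qed

text \<open>The carrier of the record is the whole type, so the extensionality condition in
  \<open>Bij\<close> holds trivially and Galois group elements are plain bijective field
  homomorphisms.\<close>

lemma carrier_galois_group:
  "\<tau> \<in> carrier (galois_group (ring_of_type_algebra :: 'a::field ring) K)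
    \<longleftrightarrow> field_hom \<tau> \<and> bij \<tau> \<and> (\<forall>x\<in>K. \<tau> x = x)"
proof -
  have "\<tau> \<in> ring_iso (ring_of_type_algebra :: 'a ring) ring_of_type_algebra \<longleftrightarrow> field_hom \<tau> \<and> bij \<tau>"
  proof
    assume "field_hom \<tau> \<and> bij \<tau>"
    then interpret field_hom \<tau> by simp
    show "\<tau> \<in> ring_iso (ring_of_type_algebra :: 'a ring) ring_of_type_algebra"
      by (rule ring_iso_memI)
        (use \<open>field_hom \<tau> \<and> bij \<tau>\<close> in \<open>simp_all add: ring_of_type_algebra_def hom_add hom_mult\<close>)
  next
    assume "\<tau> \<in> ring_iso (ring_of_type_algebra :: 'a ring) ring_of_type_algebra"
    note iso = ring_iso_memE[OF this]
    show "field_hom \<tau> \<and> bij \<tau>"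
      by (intro conjI field_homI)
        (use iso(2-5) in \<open>simp_all add: ring_of_type_algebra_def\<close>)
  qed
  then show ?thesis
    by (auto simp: galois_group_def Bij_def)
qed

lemma galois_group_one: "\<one>\<^bsub>galois_group (ring_of_type_algebra :: 'a::field ring) K\<^esub> = id"
  by (auto simp: galois_group_def BijGroup_def)

lemma galois_group_mult:
  fixes K :: "'a::field set"
  assumes "\<tau> \<in> carrier (galois_group ring_of_type_algebra K)"
    and "\<tau>' \<in> carrier (galois_group ring_of_type_algebra K)"
  shows "\<tau> \<otimes>\<^bsub>galois_group ring_of_type_algebra K\<^esub> \<tau>' = \<tau> \<circ> \<tau>'"
  using assms by (auto simp: galois_group_def BijGroup_def compose_def)

lemma group_galois_group: "group (galois_group (ring_of_type_algebra :: 'a::field ring) K)" (is "group ?G")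
proof -
  have comp: "x \<circ> y \<in> carrier ?G" if x: "x \<in> carrier ?G" and y: "y \<in> carrier ?G" for x y
  proof -
    interpret hx: field_hom x using x by (simp add: carrier_galois_group)
    interpret hy: field_hom y using y by (simp add: carrier_galois_group)
    have "field_hom (x \<circ> y)"
      by (rule field_homI) (simp_all add: hx.hom_add hy.hom_add hx.hom_mult hy.hom_mult)
    then show ?thesis
      using x y by (auto simp: carrier_galois_group intro: bij_comp)
  qed
  show ?thesis
  proof (rule groupI)
    fix x y z
    assume x: "x \<in> carrier ?G" and y: "y \<in> carrier ?G"
    then show "x \<otimes>\<^bsub>?G\<^esub> y \<in> carrier ?G"
      by (simp add: galois_group_mult comp)
    assume z: "z \<in> carrier ?G"
    show "x \<otimes>\<^bsub>?G\<^esub> y \<otimes>\<^bsub>?G\<^esub> z = x \<otimes>\<^bsub>?G\<^esub> (y \<otimes>\<^bsub>?G\<^esub> z)"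
      using x y z by (simp add: galois_group_mult comp comp_assoc)
  next
    have "field_hom (id :: 'a \<Rightarrow> 'a)"
      by (rule field_homI) simp_all
    then show one: "\<one>\<^bsub>?G\<^esub> \<in> carrier ?G"
      by (simp add: galois_group_one carrier_galois_group)
    fix x
    assume x: "x \<in> carrier ?G"
    show "\<one>\<^bsub>?G\<^esub> \<otimes>\<^bsub>?G\<^esub> x = x"
      using galois_group_mult[OF one x] by (simp add: galois_group_one)
    interpret hx: field_hom x using x by (simp add: carrier_galois_group)
    have bij: "bij x"
      using x by (simp add: carrier_galois_group)
    have inv_eq: "inv_into UNIV x u = v \<longleftrightarrow> u = x v" for u v
      using bij by (metis bij_inv_eq_iff)
    have x_inv: "x (inv_into UNIV x u) = u" for u
      using inv_eq by metis
    have "field_hom (inv_into UNIV x)"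
      by (rule field_homI) (simp_all add: inv_eq hx.hom_add hx.hom_mult x_inv)
    then have "inv_into UNIV x \<in> carrier ?G"
      using x bij by (auto simp: carrier_galois_group bij_imp_bij_inv inv_eq)
    moreover have "inv_into UNIV x \<circ> x = id"
      using bij by (simp add: bij_is_inj)
    ultimately show "\<exists>y\<in>carrier ?G. y \<otimes>\<^bsub>?G\<^esub> x = \<one>\<^bsub>?G\<^esub>"
      using x by (auto simp: galois_group_mult galois_group_one)
  qed
qed

lemma galois_group_pow:
  fixes K :: "'a::field set"
  assumes "\<tau> \<in> carrier (galois_group ring_of_type_algebra K)"
  shows "\<tau> [^]\<^bsub>galois_group ring_of_type_algebra K\<^esub> (k::nat) = \<tau> ^^ k"
proof -
  interpret group "galois_group ring_of_type_algebra K"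
    by (rule group_galois_group)
  show ?thesis
  proof (induction k)
    case (Suc k)
    then show ?case
      using galois_group_mult[OF nat_pow_closed[OF assms, of k] assms]
      by (simp add: funpow_Suc_right del: funpow.simps)
  qed (simp add: galois_group_one)
qed

text \<open>Multiplication by a nonzero \<open>x\<close> permutes the nonzero elements of
  \<open>K\<close>; comparing their product before and after gives
  \<open>x ^ (card K - 1) = 1\<close>. This is what puts the \<open>q\<close>-power map into the
  Galois group.\<close>

lemma subfield_power_card:
  fixes K :: "'a::{field,finite} set"
  assumes "subfield K ring_of_type_algebra" "x \<in> K"
  shows "x ^ card K = x"
proof (cases "x = 0")
  case True
  then show ?thesis
    using assms(2) by (auto simp: card_gt_0_iff)
next
  case False
  interpret R: field "ring_of_type_algebra :: 'a ring"
    by (rule field_from_type_algebra)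
  have zero: "0 \<in> K"
    using subringE(2)[OF subfieldE(1)[OF assms(1)] ] by (simp add: ring_of_type_algebra_def)
  have mult: "x * y \<in> K" if "y \<in> K" for y
    using subringE(6)[OF subfieldE(1)[OF assms(1)] assms(2) that] by (simp add: ring_of_type_algebra_def)
  have "(*) x ` (K - {0}) = K - {0}"
    by (rule card_subset_eq) (use False mult in \<open>auto simp: card_image inj_on_def\<close>)
  then have "(\<Prod>y\<in>K-{0}. y) = (\<Prod>y\<in>(*) x ` (K - {0}). y)"
    by simp
  also have "\<dots> = x ^ (card K - 1) * (\<Prod>y\<in>K-{0}. y)"
    using False zero by (subst prod.reindex) (auto simp: inj_on_def prod.distrib)
  finally have "x ^ (card K - 1) = 1"
    by simp
  moreover have "card K > 0"
    using zero by (auto simp: card_gt_0_iff)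
  ultimately show ?thesis
    by (metis Suc_diff_1 mult.right_neutral power_Suc)
qed

text \<open>The characteristic is a prime dividing \<open>q ^ n\<close>, hence the prime underlying
  \<open>q\<close>, and additivity is the freshman's dream.\<close>

lemma field_hom_frobenius:
  assumes "primepow q" "card (UNIV :: 'a::{field,finite} set) = q ^ n"
  shows "field_hom (\<lambda>x::'a. x ^ q)"
proof -
  obtain p k where pk: "prime p" "q = p ^ k"
    using assms(1) by (auto simp: primepow_def)
  have prime: "prime CHAR('a)"
    by (rule prime_CHAR_semidom) (simp add: finite_imp_CHAR_pos)
  have "CHAR('a) dvd p ^ (k * n)"
    using CHAR_dvd_CARD[where ?'a = 'a] assms(2) pk by (simp add: power_mult)
  then have "CHAR('a) = p"
    using prime pk(1) by (metis prime_dvd_power primes_dvd_imp_eq)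
  then show ?thesis
    by (intro field_homI) (use prime pk in \<open>auto simp: power_mult_distrib freshmans_dream'\<close>)
qed

text \<open>Descent needs the order of \<sigma> and an element with \<open>n\<close> distinct
  conjugates. Since \<theta> generates the multiplicative group, an automorphism fixing \<theta> is
  the identity, so the first return of \<theta> under \<sigma> is the order of \<sigma>.\<close>

lemma galois_generator_order:
  fixes K :: "'a::{field,finite} set"
  assumes "primepow q" and n: "n \<ge> 1" and card: "card (UNIV :: 'a set) = q ^ n"
    and K: "subfield K ring_of_type_algebra" "card K = q"
    and \<sigma>: "\<sigma> \<in> carrier (galois_group ring_of_type_algebra K)"
    and gen: "generate (galois_group ring_of_type_algebra K) {\<sigma>} = carrier (galois_group ring_of_type_algebra K)"
    and \<theta>: "\<And>x. x \<noteq> 0 \<Longrightarrow> \<exists>i::nat. x = \<theta> ^ i"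
  shows "\<sigma> ^^ n = id" and "0 < j \<Longrightarrow> j < n \<Longrightarrow> (\<sigma> ^^ j) \<theta> \<noteq> \<theta>"
proof -
  let ?G = "galois_group ring_of_type_algebra K"
  interpret group ?G by (rule group_galois_group)
  have hom: "field_hom \<sigma>" and bij: "bij \<sigma>" and fixK: "\<And>x. x \<in> K \<Longrightarrow> \<sigma> x = x"
    using \<sigma> by (auto simp: carrier_galois_group)
  have q: "q > 1"
    using primepow_gt_Suc_0[OF assms(1)] by simp
  have id_iff: "\<sigma> ^^ k = id \<longleftrightarrow> (\<sigma> ^^ k) \<theta> = \<theta>" for k
  proof
    assume "(\<sigma> ^^ k) \<theta> = \<theta>"
    then show "\<sigma> ^^ k = id"
      using field_hom_funpow[OF hom] field_hom_funpow[OF hom, of 0] \<theta>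
      by (intro field_hom_eq_on_generator[of "\<sigma> ^^ k" id \<theta>]) (simp_all add: id_def)
  qed simp
  obtain N0 where "N0 > 0" "(\<sigma> ^^ N0) \<theta> = \<theta>"
    using funpow_inj_finite[OF bij_is_inj[OF bij], of \<theta>] by auto
  define N where "N = (LEAST k. 0 < k \<and> (\<sigma> ^^ k) \<theta> = \<theta>)"
  have "0 < N \<and> (\<sigma> ^^ N) \<theta> = \<theta>"
    unfolding N_def by (rule LeastI[of _ N0]) (simp add: \<open>N0 > 0\<close> \<open>(\<sigma> ^^ N0) \<theta> = \<theta>\<close>)
  then have N: "0 < N" "\<sigma> ^^ N = id"
    by (simp_all add: id_iff)
  have less_N: "(\<sigma> ^^ k) \<theta> \<noteq> \<theta>" if "0 < k" "k < N" for k
    using that not_less_Least[of k "\<lambda>k. 0 < k \<and> (\<sigma> ^^ k) \<theta> = \<theta>"] by (auto simp: N_def)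

  \<comment> \<open>Descent for \<open>\<sigma>\<close> acting on the field itself gives \<open>q\<^sup>N \<le> q\<^sup>n\<close>; the Frobenius map being a power
    of \<open>\<sigma>\<close> gives the converse.\<close>
  interpret \<sigma>: field_hom \<sigma> by (rule hom)
  \<comment> \<open>The field is taken as a vector space over itself, with \<sigma> in both roles.
    Every element is fixed by \<open>\<sigma> ^^ N\<close>, and the fixed points of \<sigma> include
    \<open>K\<close>.\<close>
  have "card {x. (\<sigma> ^^ N) x = x} = card {x. \<sigma> x = x} ^ N"
    by (rule card_semilinear_fixed_points[OF hom N less_N, where scale = "(*)"])
      (unfold_locales, auto simp: algebra_simps \<sigma>.hom_add \<sigma>.hom_mult)
  then have "q ^ n = card {x. \<sigma> x = x} ^ N"
    using N card by simp
  moreover have "q \<le> card {x. \<sigma> x = x}"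
    using card_mono[of "{x. \<sigma> x = x}" K] K(2) fixK by auto
  ultimately have "q ^ N \<le> q ^ n"
    by (simp add: power_mono)
  then have "N \<le> n"
    using q by (simp add: power_increasing_iff)

  define F where "F = (\<lambda>x::'a. x ^ q)"
  have F_pow: "(F ^^ k) x = x ^ (q ^ k)" for k x
    by (induction k) (simp_all add: F_def power_mult[symmetric] mult.commute)
  have homF: "field_hom F"
    unfolding F_def by (rule field_hom_frobenius[OF assms(1) card])
  then interpret F: field_hom F .
  have "inj F"
  proof (rule injI)
    fix x y
    assume "F x = F y"
    then have "F (x - y) = 0"
      by (simp add: F.hom_minus)
    then show "x = y"
      by (simp add: F_def)
  qed
  then have "bij F"
    by (simp add: bij_def finite_UNIV_inj_surj)
  then have "F \<in> carrier ?G"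
    using homF subfield_power_card[OF K(1)] K(2) by (simp add: carrier_galois_group F_def)
  \<comment> \<open>Here the assumption that \<sigma> generates is used; finiteness of the group
    makes the exponent a natural number.\<close>
  then obtain m :: nat where "F = \<sigma> ^^ m"
    using generate_pow_on_finite_carrier[OF finite \<sigma>] gen by (auto simp: galois_group_pow[OF \<sigma>])
  then have "F ^^ N = (\<sigma> ^^ N) ^^ m"
    by (simp add: funpow_mult mult.commute)
  then have "F ^^ N = id"
    by (simp add: N)
  then have roots: "x ^ (q ^ N) = x" for x :: 'a
    using F_pow[of N x] by simp
  \<comment> \<open>All \<open>q ^ n\<close> field elements are roots of this polynomial, so its
    degree bounds \<open>q ^ n\<close>.\<close>
  define P :: "'a poly" where "P = monom 1 (q ^ N) - monom 1 1"
  have "q ^ N > 1"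
    using q N(1) by (rule one_less_power)
  then have "coeff P (q ^ N) = 1"
    by (simp add: P_def)
  then have "P \<noteq> 0"
    by auto
  have "UNIV = {x. poly P x = 0}"
    by (simp add: P_def poly_monom roots)
  then have "q ^ n \<le> degree P"
    using card_poly_roots_bound[OF \<open>P \<noteq> 0\<close>] card by simp
  also have "degree P \<le> q ^ N"
    unfolding P_def using \<open>q ^ N > 1\<close>
    by (intro degree_diff_le) (auto intro: order.trans[OF degree_monom_le])
  finally have "q ^ n \<le> q ^ N" .
  then have "n \<le> N"
    using q by (simp add: power_increasing_iff)
  with \<open>N \<le> n\<close> have "N = n"
    by simp
  with N less_N show "\<sigma> ^^ n = id" and "0 < j \<Longrightarrow> j < n \<Longrightarrow> (\<sigma> ^^ j) \<theta> \<noteq> \<theta>"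
    by auto
qed

subsection \<open>The semilinear map of the companion matrix\<close>

lemma companion_carrier [simp]: "companion a b c d \<in> carrier_mat 3 3"
  by (rule carrier_matI) (simp_all add: companion_def mat_of_rows_list_def numeral_3_eq_3)

lemma companion_dim [simp]: "dim_row (companion a b c d) = 3" "dim_col (companion a b c d) = 3"
  by (rule carrier_matD[OF companion_carrier])+

text \<open>\<open>foldr\<close> leaves its seed at the right end. Pulling the seed out lets the
  twisted product gain its next factor on the right.\<close>

lemma foldr_mult_mat:
  assumes "set Ms \<subseteq> carrier_mat n n" "M \<in> carrier_mat n n"
  shows "foldr (*) Ms M \<in> carrier_mat n n"
    and "foldr (*) Ms M = foldr (*) Ms (1\<^sub>m n) * (M :: 'a::semiring_1 mat)"
proof -
  have carrier: "foldr (*) Ms M \<in> carrier_mat n n"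
    if "set Ms \<subseteq> carrier_mat n n" "M \<in> carrier_mat n n" for Ms and M :: "'a mat"
    using that by (induction Ms) auto
  show "foldr (*) Ms M \<in> carrier_mat n n"
    using carrier assms .
  show "foldr (*) Ms M = foldr (*) Ms (1\<^sub>m n) * M"
    using assms
  proof (induction Ms)
    case (Cons N Ms)
    then have "N * (foldr (*) Ms (1\<^sub>m n) * M) = N * foldr (*) Ms (1\<^sub>m n) * M"
      using carrier[of Ms "1\<^sub>m n"] by (intro assoc_mult_mat[symmetric]) auto
    then show ?case
      using Cons by simp
  qed simp
qed

lemma twisted_companion_prod_carrier [simp]:
  "twisted_companion_prod k \<sigma> a b c d \<in> carrier_mat 3 3"
  unfolding twisted_companion_prod_def by (rule foldr_mult_mat(1)) auto

lemma twisted_companion_prod_0: "twisted_companion_prod 0 \<sigma> a b c d = 1\<^sub>m 3"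
  by (simp add: twisted_companion_prod_def)

lemma twisted_companion_prod_Suc:
  "twisted_companion_prod (Suc k) \<sigma> a b c d
    = twisted_companion_prod k \<sigma> a b c d * map_mat (\<sigma> ^^ k) (companion a b c d)"
  unfolding twisted_companion_prod_def
  by (simp, subst foldr_mult_mat(2)[where n = 3]) (auto simp: right_mult_one_mat[of _ 3 3])

text \<open>Triples form a finite type that is an additive group, as the descent lemma requires; the
  type \<open>'a vec\<close> mixes all dimensions.\<close>

definition vec3 :: "'a \<times> 'a \<times> 'a \<Rightarrow> 'a vec" where
  "vec3 v = vec 3 (\<lambda>i. if i = 0 then fst v else if i = 1 then fst (snd v) else snd (snd v))"

lemma vec3_carrier [simp]: "vec3 v \<in> carrier_vec 3"
  by (simp add: vec3_def)

lemma map_vec_vec3: "map_vec h (vec3 (x, y, z)) = vec3 (h x, h y, h z)"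
  by (rule eq_vecI) (auto simp: vec3_def)

lemma less_3_cases: "i < (3::nat) \<Longrightarrow> i = 0 \<or> i = 1 \<or> i = 2"
  by auto

lemma bij_betw_vec3: "bij_betw vec3 UNIV (carrier_vec 3)"
proof (rule bij_betw_byWitness[where f' = "\<lambda>u. (vec_index u 0, vec_index u 1, vec_index u 2)"])
  show "\<forall>u\<in>carrier_vec 3. vec3 (vec_index u 0, vec_index u 1, vec_index u 2) = u"
    by (auto simp: vec3_def vec_eq_iff dest!: less_3_cases)
qed (auto simp: vec3_def)

text \<open>The row action of the companion matrix, written with the transpose: it shifts the triple
  and appends the value that the equation of \<open>L\<close> prescribes for the next term.\<close>

lemma companion_transpose_mult_vec3:
  "(companion a b c d)\<^sup>T *\<^sub>v vec3 (x, y, z) = vec3 (y, z, - (a / d) * x - (b / d) * y - (c / d) * z)"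
proof (rule eq_vecI)
  let ?C = "companion a b c d"
  fix i
  assume "i < dim_vec (vec3 (y, z, - (a / d) * x - (b / d) * y - (c / d) * z))"
  then have i: "i < 3"
    by (simp add: vec3_def)
  then have "vec_index (?C\<^sup>T *\<^sub>v vec3 (x, y, z)) i = ?C $$ (0, i) * x + ?C $$ (1, i) * y + ?C $$ (2, i) * z"
    by (simp add: scalar_prod_def vec3_def numeral_3_eq_3 numeral_2_eq_2)
  also have "\<dots> = vec_index (vec3 (y, z, - (a / d) * x - (b / d) * y - (c / d) * z)) i"
    using less_3_cases[OF i]
    by (elim disjE) (simp_all add: companion_def mat_of_rows_list_def vec3_def)
  finally show "vec_index (?C\<^sup>T *\<^sub>v vec3 (x, y, z)) i
    = vec_index (vec3 (y, z, - (a / d) * x - (b / d) * y - (c / d) * z)) i" .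
qed (simp add: vec3_def)

lemma mat_kernel_char_matrix_transpose:
  assumes A: "A \<in> carrier_mat n n" and v: "v \<in> carrier_vec n"
  shows "v \<in> mat_kernel (char_matrix A 1)\<^sup>T \<longleftrightarrow> A\<^sup>T *\<^sub>v v = (v :: 'a::field vec)"
proof -
  have zero: "B *\<^sub>v 0\<^sub>v n = 0\<^sub>v n" if "B \<in> carrier_mat n n" for B :: "'a mat"
    by (rule eq_vecI) (use that in auto)
  have "(char_matrix A 1)\<^sup>T = char_matrix A\<^sup>T 1"
    using A by (auto simp: char_matrix_def)
  moreover have "char_matrix A\<^sup>T 1 *\<^sub>v v = 0\<^sub>v n \<longleftrightarrow> A\<^sup>T *\<^sub>v v = v"
  \<comment> \<open>Eigenvectors are nonzero by definition, so the zero vector is treated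
    separately.\<close>
  proof (cases "v = 0\<^sub>v n")
    case True
    then show ?thesis
      using A by (simp add: zero)
  next
    case False
    then show ?thesis
      using eigenvector_char_matrix[of "A\<^sup>T" n v 1] A v by (auto simp: eigenvector_def)
  qed
  ultimately show ?thesis
    using A v mat_kernel[of "char_matrix A\<^sup>T 1" n n] by simp
qed

text \<open>Both sides count the left eigenspace of the twisted product for 1: the left side by
  descent from the roots, the right side by dimension after transposing.\<close>

lemma card_roots_linearized_power:
  fixes \<sigma> :: "'a::{field,finite} \<Rightarrow> 'a"
  assumes hom: "field_hom \<sigma>" and n: "n \<ge> 1" and id: "\<sigma> ^^ n = id"
    and \<theta>: "\<And>j. 0 < j \<Longrightarrow> j < n \<Longrightarrow> (\<sigma> ^^ j) \<theta> \<noteq> \<theta>"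
    and d: "d \<noteq> 0"
  shows "card {x. linearized \<sigma> a b c d x = 0} ^ n
    = card (UNIV :: 'a set) ^ geom_mult (twisted_companion_prod n \<sigma> a b c d) 1"
proof -
  interpret \<sigma>: field_hom \<sigma> by (rule hom)
  \<comment> \<open>This is the inverse of \<sigma>, written as a power so that it is visibly a
    homomorphism; for \<open>n = 1\<close> it is the identity, as is \<sigma>.\<close>
  define \<psi> where "\<psi> = \<sigma> ^^ (n - 1)"
  have hom_\<psi>: "field_hom \<psi>"
    unfolding \<psi>_def by (rule field_hom_funpow[OF hom])
  then interpret \<psi>: field_hom \<psi> .
  have \<sigma>\<psi>: "\<sigma> (\<psi> x) = x" and \<psi>\<sigma>: "\<psi> (\<sigma> x) = x" for x
  proof -
    have "\<sigma> \<circ> \<psi> = \<sigma> ^^ Suc (n - 1)"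
      by (simp only: \<psi>_def funpow.simps)
    moreover have "\<psi> \<circ> \<sigma> = \<sigma> ^^ Suc (n - 1)"
      by (simp only: \<psi>_def funpow_Suc_right)
    ultimately show "\<sigma> (\<psi> x) = x" and "\<psi> (\<sigma> x) = x"
      using n id by (simp_all add: fun_eq_iff)
  qed
  have pow_inverse: "(\<sigma> ^^ j) ((\<psi> ^^ j) x) = x" for j x
    by (induction j arbitrary: x) (simp_all add: \<sigma>\<psi> funpow_swap1)
  define \<phi> where "\<phi> = (\<lambda>(x, y, z). (\<psi> y, \<psi> z, \<psi> (- (a / d) * x - (b / d) * y - (c / d) * z)))"
  let ?A = "\<lambda>k. twisted_companion_prod k \<sigma> a b c d"
  have step: "map_vec \<sigma> (vec3 (\<phi> v)) = (companion a b c d)\<^sup>T *\<^sub>v vec3 v" for v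
    by (cases v) (simp only: \<phi>_def prod.case companion_transpose_mult_vec3 map_vec_vec3 \<sigma>\<psi>)
  \<comment> \<open>In the induction step one application of \<phi> uses up one \<sigma> and yields
    the transposed companion matrix; the remaining \<open>\<sigma> ^^ k\<close> then twists its
    entries.\<close>
  have iterate: "map_vec (\<sigma> ^^ k) (vec3 ((\<phi> ^^ k) v)) = (?A k)\<^sup>T *\<^sub>v vec3 v" for k v
  proof (induction k)
    case 0
    then show ?case
      by (cases v) (simp add: twisted_companion_prod_0 map_vec_vec3)
  next
    case (Suc k)
    interpret k: field_hom "\<sigma> ^^ k" by (rule field_hom_funpow[OF hom])
    let ?w = "(\<phi> ^^ k) v" and ?C = "companion a b c d"
    have "map_vec (\<sigma> ^^ Suc k) (vec3 ((\<phi> ^^ Suc k) v)) = map_vec (\<sigma> ^^ k) (map_vec \<sigma> (vec3 (\<phi> ?w)))"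
      by (rule eq_vecI) (simp_all add: funpow_swap1)
    also have "\<dots> = map_mat (\<sigma> ^^ k) ?C\<^sup>T *\<^sub>v map_vec (\<sigma> ^^ k) (vec3 ?w)"
      unfolding step by (rule k.mult_mat_vec_hom[where nr = 3 and n = 3]) simp_all
    also have "\<dots> = (map_mat (\<sigma> ^^ k) ?C)\<^sup>T *\<^sub>v ((?A k)\<^sup>T *\<^sub>v vec3 v)"
      by (simp add: Suc map_mat_transpose)
    also have "\<dots> = ((map_mat (\<sigma> ^^ k) ?C)\<^sup>T * (?A k)\<^sup>T) *\<^sub>v vec3 v"
      by (rule assoc_mult_mat_vec[symmetric, where ?n\<^sub>1 = 3 and ?n\<^sub>2 = 3 and ?n\<^sub>3 = 3]) simp_all
    also have "(map_mat (\<sigma> ^^ k) ?C)\<^sup>T * (?A k)\<^sup>T = (?A (Suc k))\<^sup>T"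
      unfolding twisted_companion_prod_Suc
      by (rule transpose_mult[symmetric, where nr = 3 and n = 3 and nc = 3]) simp_all
    finally show ?case .
  qed
  have \<phi>_n: "vec3 ((\<phi> ^^ n) v) = (?A n)\<^sup>T *\<^sub>v vec3 v" for v
    using iterate[of n v] id by (simp add: map_vec_def) (metis dim_vec eq_vecI id_apply index_vec)

  define scale where "scale = (\<lambda>(e::'a) (x, y, z). (e * x, e * y, e * z))"
  have "card {v. (\<phi> ^^ n) v = v} = card {v. \<phi> v = v} ^ n"
  proof (rule card_semilinear_fixed_points[OF hom_\<psi>, where scale = scale and \<theta> = \<theta>])
    have "\<psi> ^^ n = (\<sigma> ^^ n) ^^ (n - 1)"
      by (simp add: \<psi>_def funpow_mult mult.commute)
    then show "\<psi> ^^ n = id"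
      by (simp add: id)
    show "(\<psi> ^^ j) \<theta> \<noteq> \<theta>" if "0 < j" "j < n" for j
      \<comment> \<open>If \<open>\<psi> ^^ j\<close> fixed \<theta>, applying
        \<open>\<sigma> ^^ j\<close> would show that \<open>\<sigma> ^^ j\<close> fixes \<theta>
        too.\<close>
      using \<theta>[OF that] pow_inverse[of j \<theta>] by metis
    show "vector_space scale"
      by unfold_locales (auto simp: scale_def algebra_simps)
    show "\<phi> (v + w) = \<phi> v + \<phi> w" for v w
      by (cases v; cases w) (simp add: \<phi>_def algebra_simps add_divide_distrib flip: \<psi>.hom_add)
    show "\<phi> (scale e v) = scale (\<psi> e) (\<phi> v)" for e v
      by (cases v) (simp add: \<phi>_def scale_def algebra_simps flip: \<psi>.hom_mult)
  qed (use n in simp)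
  moreover have "card {v. \<phi> v = v} = card {x. linearized \<sigma> a b c d x = 0}"
  \<comment> \<open>For a triple \<open>(x, y, z)\<close> the first two fixed-point equations say
    \<open>y = \<sigma> x\<close> and \<open>z = \<sigma> y\<close>; the third then says that
    \<open>x\<close> is a root.\<close>
  proof (rule bij_betw_same_card[of fst], rule bij_betw_byWitness[where f' = "\<lambda>x. (x, \<sigma> x, \<sigma> (\<sigma> x))"])
    have \<psi>_iff: "\<psi> u = w \<longleftrightarrow> u = \<sigma> w" for u w
      using \<sigma>\<psi> \<psi>\<sigma> by metis
    have "linearized \<sigma> a b c d x
        = d * (\<sigma> (\<sigma> (\<sigma> x)) - (- (a / d) * x - (b / d) * \<sigma> x - (c / d) * \<sigma> (\<sigma> x)))" for x
      using d by (simp add: linearized_def numeral_3_eq_3 numeral_2_eq_2 algebra_simps)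
    then have root: "- (a / d) * x - (b / d) * \<sigma> x - (c / d) * \<sigma> (\<sigma> x) = \<sigma> (\<sigma> (\<sigma> x))
        \<longleftrightarrow> linearized \<sigma> a b c d x = 0" for x
      using d by (simp only: mult_eq_0_iff right_minus_eq) auto
    show "\<forall>v\<in>{v. \<phi> v = v}. (fst v, \<sigma> (fst v), \<sigma> (\<sigma> (fst v))) = v"
      by (auto simp: \<phi>_def \<psi>_iff)
    show "fst ` {v. \<phi> v = v} \<subseteq> {x. linearized \<sigma> a b c d x = 0}"
      by (auto simp: \<phi>_def \<psi>_iff root[symmetric] \<sigma>\<psi>)
    show "(\<lambda>x. (x, \<sigma> x, \<sigma> (\<sigma> x))) ` {x. linearized \<sigma> a b c d x = 0} \<subseteq> {v. \<phi> v = v}"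
      by (auto simp: \<phi>_def \<psi>_iff root[symmetric])
  qed simp
  moreover have "card {v. (\<phi> ^^ n) v = v} = card (mat_kernel (char_matrix (?A n) 1)\<^sup>T)"
  proof (rule bij_betw_same_card)
    have "vec3 ` {v. (\<phi> ^^ n) v = v} = mat_kernel (char_matrix (?A n) 1)\<^sup>T"
    proof -
      have iff: "vec3 v \<in> mat_kernel (char_matrix (?A n) 1)\<^sup>T \<longleftrightarrow> (\<phi> ^^ n) v = v" for v
        using mat_kernel_char_matrix_transpose[of "?A n" 3 "vec3 v"] bij_betw_vec3[where 'a = 'a]
        by (simp add: \<phi>_n[symmetric] bij_betw_def inj_eq)
      have "mat_kernel (char_matrix (?A n) 1)\<^sup>T \<subseteq> vec3 ` UNIV"
        using mat_kernel_carrier[of "(char_matrix (?A n) 1)\<^sup>T" 3 3] bij_betw_vec3[where 'a = 'a]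
        by (simp add: bij_betw_def)
      with iff show ?thesis
        by blast
    qed
    then show "bij_betw vec3 {v. (\<phi> ^^ n) v = v} (mat_kernel (char_matrix (?A n) 1)\<^sup>T)"
      using bij_betw_vec3[where 'a = 'a] by (auto simp: bij_betw_def intro: inj_on_subset)
  qed
  ultimately show ?thesis
    using card_mat_kernel_transpose[of "char_matrix (?A n) 1" 3] card_mat_kernel[of "char_matrix (?A n) 1" 3 3]
    by (simp add: geom_mult_def)
qed

section \<open>Comparison of exponents of \<open>q\<close>\<close>

theorem theorem13:
  fixes q n :: nat
    and K :: "'a :: {field, finite} set"
    and \<sigma> :: "'a \<Rightarrow> 'a"
    and a b c d :: 'a
  assumes "primepow q"
    and "n \<ge> 1"
    and "card (UNIV :: 'a set) = q ^ n"
    and "subfield K ring_of_type_algebra"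
    and "card K = q"
    and "\<sigma> \<in> carrier (galois_group ring_of_type_algebra K)"
    and "generate (galois_group ring_of_type_algebra K) {\<sigma>} = carrier (galois_group ring_of_type_algebra K)"
    and "d \<noteq> 0"
    and "a \<noteq> 0"
  shows "\<forall>g \<in> {0, 1, 2, 3 :: nat}.
    card {x :: 'a. linearized \<sigma> a b c d x = 0} = q ^ g \<longleftrightarrow>
    eigenvalue_with_geom_mult (twisted_companion_prod n \<sigma> a b c d) 1 g"
proof
  fix g :: nat
  let ?A = "twisted_companion_prod n \<sigma> a b c d"
  let ?g = "geom_mult ?A 1"
  have q: "q > 1"
    using primepow_gt_Suc_0[OF assms(1)] by simp
  obtain \<theta> :: 'a where \<theta>: "\<And>x. x \<noteq> 0 \<Longrightarrow> \<exists>i::nat. x = \<theta> ^ i"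
    using finite_field_generator by blast
  have "card {x. linearized \<sigma> a b c d x = 0} ^ n = card (UNIV :: 'a set) ^ ?g"
    by (rule card_roots_linearized_power[OF _ assms(2)
          galois_generator_order[OF assms(1-7) \<theta>] assms(8)])
      (use assms(6) in \<open>simp_all add: carrier_galois_group\<close>)
  also have "\<dots> = (q ^ ?g) ^ n"
    by (simp add: assms(3) power_mult[symmetric] mult.commute)
  finally have roots: "card {x. linearized \<sigma> a b c d x = 0} = q ^ ?g"
    using assms(2) by (simp add: power_eq_iff_eq_base)
  \<comment> \<open>This settles the convention for multiplicity 0: the eigenspace has
    \<open>(q ^ n) ^ ?g\<close> elements, which is 1 exactly when \<open>?g = 0\<close>.\<close>
  have eigenvalue: "eigenvalue ?A 1 \<longleftrightarrow> ?g \<noteq> 0"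
  proof -
    let ?K = "mat_kernel (char_matrix ?A 1)"
    have K: "?K = {v \<in> carrier_vec 3. char_matrix ?A 1 *\<^sub>v v = 0\<^sub>v 3}"
      using mat_kernel[of "char_matrix ?A 1" 3 3] by simp
    have "0\<^sub>v 3 \<in> ?K"
      unfolding K by (auto simp: char_matrix_def carrier_matD[OF twisted_companion_prod_carrier] intro!: eq_vecI)
    moreover have "eigenvalue ?A 1 \<longleftrightarrow> (\<exists>v \<in> ?K. v \<noteq> 0\<^sub>v 3)"
      unfolding eigenvalue_char_matrix[OF twisted_companion_prod_carrier] K by auto
    ultimately have "eigenvalue ?A 1 \<longleftrightarrow> ?K \<noteq> {0\<^sub>v 3}"
      by auto
    also have "\<dots> \<longleftrightarrow> card ?K \<noteq> 1"
      using \<open>0\<^sub>v 3 \<in> ?K\<close> by (auto simp: card_1_singleton_iff)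
    also have "card ?K = (q ^ n) ^ ?g"
      using card_mat_kernel[of "char_matrix ?A 1" 3 3] by (simp add: geom_mult_def assms(3))
    also have "(q ^ n) ^ ?g \<noteq> 1 \<longleftrightarrow> ?g \<noteq> 0"
      using q assms(2) by (simp add: power_mult[symmetric])
    finally show ?thesis .
  qed
  show "card {x. linearized \<sigma> a b c d x = 0} = q ^ g \<longleftrightarrow> eigenvalue_with_geom_mult ?A 1 g"
    \<comment> \<open>Since \<open>q > 1\<close>, equal powers of \<open>q\<close> have equal
      exponents.\<close>
    using q by (auto simp: roots eigenvalue_with_geom_mult_def eigenvalue)
qed

end
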